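(* Let $G_1,\dots,G_n$ be simple connected graphs, each with at least one edge, $m_i=|E(G_i)|$, and let $G=G_1\oplus_{v_{1,2}}G_2\oplus_{v_{2,3}}\cdots\oplus_{v_{n-1,n}}G_n$ be the chain of 1-sums described in the context. For $i\neq j$ define $v_{q_{i,j}}=v_{j-1,j}$ if $j>i$ and $v_{q_{i,j}}=v_{j,j+1}$ if $j<i$. Then $$\mathscr{K}(G)=\frac{\sum_{i=1}^n m_i\left(\mathscr{K}(G_i)+\sum_{j\ne i}\mu(G_j,v_{q_{i,j}})\right)+2\sum_{1\le i<j\le n,\ j-i\ge2} m_im_j\, r_G(v_{i,i+1},v_{j-1,j})}{\sum_{i=1}^n m_i}.$$
   Context: All graphs are finite, simple, undirected. For a connected graph $H$ with Laplacian $L$, the effective resistance is $r_H(i,j)=(e_i-e_j)^TL^\dagger(e_i-e_j)$ ($L^\dagger$ the Moore–Penrose pseudoinverse), i.e. the resistance between $i$ and $j$ with unit resistors on edges. For a connected graph $H$ with $m\ge1$ edges and degrees $d_i$, Kemeny's constant is $\mathscr{K}(H)=\sum_j\pi_jm_{ij}$ for the simple random walk on $H$ ($\pi_j=d_j/2m$, $m_{ij}$ expected hitting time of $j$ from $i$, $m_{jj}=0$), which equals $\frac{1}{4m}\sum_{i,j}d_id_jr_H(i,j)$. The moment of a vertex $v$ of $H$ is $\mu(H,v)=\sum_{i\in V(H)}d_i\,r_H(i,v)$. The chain 1-sum $G_1\oplus_{v_{1,2}}G_2\oplus\cdots\oplus_{v_{n-1,n}}G_n$ is obtained from the disjoint union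 of $G_1,\dots,G_n$ by, for each $i=1,\dots,n-1$, identifying a chosen vertex of $G_i$ with a chosen vertex of $G_{i+1}$; the resulting vertex is called $v_{i,i+1}$ and belongs to both $G_i$ and $G_{i+1}$ (the vertices $v_{i-1,i}$ and $v_{i,i+1}$ of $G_i$ may coincide). *)

theory Defs
  imports "HOL-Probability.Probability" "Graph_Theory.Graph_Theory"
begin

text \<open>
  A finite simple undirected graph is a \<^locale>\<open>pair_graph\<close>: a finite vertex set with a symmetric,
  irreflexive adjacency relation \<^const>\<open>parcs\<close>. Each undirected edge accounts for two arcs.
\<close>

definition edges :: "'a pair_pre_digraph \<Rightarrow> 'a set set" where
  "edges H = {{u, v} | u v. (u, v) \<in> parcs H}"

definition nbrs :: "'a pair_pre_digraph \<Rightarrow> 'a \<Rightarrow> 'a set" where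
  "nbrs H v = {w. (v, w) \<in> parcs H}"

definition deg :: "'a pair_pre_digraph \<Rightarrow> 'a \<Rightarrow> nat" where
  "deg H v = card (nbrs H v)"


text \<open>
  Matrices indexed by a finite set \<open>V\<close> are functions of two arguments. The pseudoinverse is pinned
  down by the four Penrose conditions, and is zero outside \<open>V \<times> V\<close> so that it is a unique function.
\<close>

definition mat_times :: "'a set \<Rightarrow> ('a \<Rightarrow> 'a \<Rightarrow> real) \<Rightarrow> ('a \<Rightarrow> 'a \<Rightarrow> real) \<Rightarrow> 'a \<Rightarrow> 'a \<Rightarrow> real" where
  "mat_times V A B = (\<lambda>i j. \<Sum>k\<in>V. A i k * B k j)"

definition is_pseudoinverse :: "'a set \<Rightarrow> ('a \<Rightarrow> 'a \<Rightarrow> real) \<Rightarrow> ('a \<Rightarrow> 'a \<Rightarrow> real) \<Rightarrow> bool" where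
  "is_pseudoinverse V A P \<longleftrightarrow>
     (\<forall>i\<in>V. \<forall>j\<in>V.
        mat_times V (mat_times V A P) A i j = A i j \<and>
        mat_times V (mat_times V P A) P i j = P i j \<and>
        mat_times V A P i j = mat_times V A P j i \<and>
        mat_times V P A i j = mat_times V P A j i)"

definition pseudoinverse :: "'a set \<Rightarrow> ('a \<Rightarrow> 'a \<Rightarrow> real) \<Rightarrow> 'a \<Rightarrow> 'a \<Rightarrow> real" where
  "pseudoinverse V A =
     (THE P. is_pseudoinverse V A P \<and> (\<forall>i j. i \<notin> V \<or> j \<notin> V \<longrightarrow> P i j = 0))"

definition laplacian :: "'a pair_pre_digraph \<Rightarrow> 'a \<Rightarrow> 'a \<Rightarrow> real" where
  "laplacian H i j =
     (if i = j then real (deg H i) else if (i, j) \<in> parcs H then - 1 else 0)"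

definition unit_vec :: "'a \<Rightarrow> 'a \<Rightarrow> real" where
  "unit_vec i x = (if x = i then 1 else 0)"

definition eff_res :: "'a pair_pre_digraph \<Rightarrow> 'a \<Rightarrow> 'a \<Rightarrow> real" where
  "eff_res H i j =
     (\<Sum>x\<in>pverts H. \<Sum>y\<in>pverts H.
        (unit_vec i x - unit_vec j x) * pseudoinverse (pverts H) (laplacian H) x y
          * (unit_vec i y - unit_vec j y))"

definition moment :: "'a pair_pre_digraph \<Rightarrow> 'a \<Rightarrow> real" where
  "moment H v = (\<Sum>i\<in>pverts H. real (deg H i) * eff_res H i v)"


text \<open>
  \<open>walk H t v\<close> is the joint law of the positions \<open>[X\<^sub>0, \<dots>, X\<^sub>t]\<close> of the simple random walk with
  \<open>X\<^sub>0 = v\<close>. It is only meaningful when every vertex has a neighbour.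
\<close>

primrec walk :: "'a pair_pre_digraph \<Rightarrow> nat \<Rightarrow> 'a \<Rightarrow> 'a list pmf" where
  "walk H 0 v = return_pmf [v]"
| "walk H (Suc t) v = bind_pmf (pmf_of_set (nbrs H v)) (\<lambda>w. map_pmf (\<lambda>xs. v # xs) (walk H t w))"

definition hit_prob :: "'a pair_pre_digraph \<Rightarrow> 'a \<Rightarrow> 'a \<Rightarrow> nat \<Rightarrow> real" where
  "hit_prob H i j t =
     measure_pmf.prob (walk H t i) {xs. xs ! t = j \<and> (\<forall>s<t. xs ! s \<noteq> j)}"

text \<open>
  The expectation \<open>E T = (\<Sum>t. t * P(T = t))\<close> of the first time \<open>T \<ge> 0\<close> at which the walk from \<open>i\<close> is at
  \<open>j\<close>. On a finite connected graph \<open>T\<close> is almost surely finite and the series converges.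
\<close>

definition hitting_time :: "'a pair_pre_digraph \<Rightarrow> 'a \<Rightarrow> 'a \<Rightarrow> real" where
  "hitting_time H i j = (\<Sum>t. real t * hit_prob H i j t)"

definition stationary :: "'a pair_pre_digraph \<Rightarrow> 'a \<Rightarrow> real" where
  "stationary H j = real (deg H j) / (2 * real (card (edges H)))"

text \<open>The common value of the sum over all starting vertices \<open>i\<close>.\<close>

definition kemeny :: "'a pair_pre_digraph \<Rightarrow> real" where
  "kemeny H = (THE K. \<forall>i\<in>pverts H. K = (\<Sum>j\<in>pverts H. stationary H j * hitting_time H i j))"


text \<open>
  The chain 1-sum of \<open>G 1, \<dots>, G n\<close> is the quotient of the disjoint union, whose vertices are the pairs
  \<open>(i, x)\<close> with \<open>x\<close> a vertex of \<open>G i\<close>, by the equivalence relation generated by identifying the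
  chosen vertex \<open>rv i\<close> of \<open>G i\<close> with the chosen vertex \<open>lv (i + 1)\<close> of \<open>G (i + 1)\<close>, for \<open>1 \<le> i < n\<close>.
  Thus \<open>lv i\<close> and \<open>rv i\<close> (possibly equal) are the vertices of \<open>G i\<close> that become \<open>v\<^bsub>i-1,i\<^esub>\<close> and
  \<open>v\<^bsub>i,i+1\<^esub>\<close>; the values \<open>lv 1\<close> and \<open>rv n\<close> play no role.
\<close>

definition glue :: "nat \<Rightarrow> (nat \<Rightarrow> 'a) \<Rightarrow> (nat \<Rightarrow> 'a) \<Rightarrow> (nat \<times> 'a) rel" where
  "glue n lv rv = {((i, rv i), (i + 1, lv (i + 1))) | i. 1 \<le> i \<and> i < n}"

definition glue_equiv :: "nat \<Rightarrow> (nat \<Rightarrow> 'a) \<Rightarrow> (nat \<Rightarrow> 'a) \<Rightarrow> (nat \<times> 'a) rel" where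
  "glue_equiv n lv rv = (glue n lv rv \<union> (glue n lv rv)\<inverse>)\<^sup>*"

definition glue_class :: "nat \<Rightarrow> (nat \<Rightarrow> 'a) \<Rightarrow> (nat \<Rightarrow> 'a) \<Rightarrow> nat \<Rightarrow> 'a \<Rightarrow> (nat \<times> 'a) set" where
  "glue_class n lv rv i x = glue_equiv n lv rv `` {(i, x)}"

definition chain_sum ::
  "nat \<Rightarrow> (nat \<Rightarrow> 'a pair_pre_digraph) \<Rightarrow> (nat \<Rightarrow> 'a) \<Rightarrow> (nat \<Rightarrow> 'a) \<Rightarrow> (nat \<times> 'a) set pair_pre_digraph" where
  "chain_sum n G lv rv =
     \<lparr> pverts = {glue_class n lv rv i x | i x. i \<in> {1..n} \<and> x \<in> pverts (G i)},
       parcs = {(glue_class n lv rv i x, glue_class n lv rv i y) | i x y.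
                  i \<in> {1..n} \<and> (x, y) \<in> parcs (G i)} \<rparr>"

text \<open>The vertex \<open>v\<^bsub>i,i+1\<^esub>\<close>, which is also \<open>glue_class n lv rv (i + 1) (lv (i + 1))\<close>.\<close>

definition cut_vertex :: "nat \<Rightarrow> (nat \<Rightarrow> 'a) \<Rightarrow> (nat \<Rightarrow> 'a) \<Rightarrow> nat \<Rightarrow> (nat \<times> 'a) set" where
  "cut_vertex n lv rv i = glue_class n lv rv i (rv i)"

text \<open>
  The copy in \<open>G j\<close> of \<open>v\<^bsub>j-1,j\<^esub>\<close> if \<open>j > i\<close> and of \<open>v\<^bsub>j,j+1\<^esub>\<close> if \<open>j < i\<close>, i.e. the vertex of \<open>G j\<close> facing
  \<open>G i\<close>. Used for \<open>i \<noteq> j\<close> only.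
\<close>

definition facing_vertex :: "(nat \<Rightarrow> 'a) \<Rightarrow> (nat \<Rightarrow> 'a) \<Rightarrow> nat \<Rightarrow> nat \<Rightarrow> 'a" where
  "facing_vertex lv rv i j = (if j > i then lv j else rv j)"

end

theory Submission
  imports Defs
begin

text \<open>
  Hitting times solve \<open>L h\<^sub>j = d - 2m e\<^sub>j\<close>, so \<open>(h\<^sub>j - h\<^sub>i) / 2m\<close> is the potential of a unit current from \<open>i\<close>
  to \<open>j\<close>. This yields the pseudoinverse of \<open>L\<close>, the commute time identity, and
  \<open>K = (\<Sum> d\<^sub>i d\<^sub>j r\<^sub>i\<^sub>j) / 4m\<close>. In a chain, the degree-weighted sum over vertices splits over the components,
  and resistances add up along cut vertices: \<open>r(x, y) = r(x, v\<^bsub>i,i+1\<^esub>) + r(v\<^bsub>i,i+1\<^esub>, v\<^bsub>j-1,j\<^esub>) + r(v\<^bsub>j-1,j\<^esub>, y)\<close>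
  for \<open>x\<close> in \<open>G\<^sub>i\<close> and \<open>y\<close> in \<open>G\<^sub>j\<close> with \<open>i < j\<close>. Multiplying out gives the formula.
\<close>

text \<open>Total probability over a uniform first choice; this drives the one-step recursion for
  \<open>hit_prob\<close>.\<close>

lemma measure_bind_pmf_of_set:
  assumes "finite S" "S \<noteq> {}"
  shows "measure_pmf.prob (bind_pmf (pmf_of_set S) N) X = (\<Sum>w\<in>S. measure_pmf.prob (N w) X) / card S"
proof -
  have "ennreal (measure_pmf.prob (bind_pmf (pmf_of_set S) N) X) = emeasure (bind_pmf (pmf_of_set S) N) X"
    by (simp add: measure_pmf.emeasure_eq_measure)
  also have "\<dots> = (\<Sum>w\<in>S. emeasure (N w) X) / card S"
    using assms by (simp add: nn_integral_pmf_of_set)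
  also have "\<dots> = ennreal ((\<Sum>w\<in>S. measure_pmf.prob (N w) X) / card S)"
    using assms
    by (simp add: measure_pmf.emeasure_eq_measure sum_ennreal sum_nonneg card_gt_0_iff
        ennreal_of_nat_eq_real_of_nat divide_ennreal)
  finally show ?thesis
    by (simp add: sum_nonneg divide_nonneg_nonneg)
qed

section \<open>Dirichlet form and unit potentials\<close>

definition dirichlet :: "'a pair_pre_digraph \<Rightarrow> ('a \<Rightarrow> real) \<Rightarrow> ('a \<Rightarrow> real) \<Rightarrow> real" where
  "dirichlet H f g = (\<Sum>(u, v)\<in>parcs H. (f u - f v) * (g u - g v))"

definition lap :: "'a pair_pre_digraph \<Rightarrow> ('a \<Rightarrow> real) \<Rightarrow> 'a \<Rightarrow> real" where
  "lap H f x = (\<Sum>y\<in>nbrs H x. f x - f y)"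

text \<open>
  The weak form of \<open>L f = e\<^sub>i - e\<^sub>j\<close>: \<open>f\<close> is the potential of a unit current from \<open>i\<close> to \<open>j\<close>. The factor
  2 is there because \<^const>\<open>dirichlet\<close> counts each edge in both directions.
\<close>

definition unit_potential :: "'a pair_pre_digraph \<Rightarrow> 'a \<Rightarrow> 'a \<Rightarrow> ('a \<Rightarrow> real) \<Rightarrow> bool" where
  "unit_potential H i j f \<longleftrightarrow> (\<forall>g. dirichlet H f g = 2 * (g i - g j))"

lemma dirichlet_commute: "dirichlet H f g = dirichlet H g f"
  by (simp add: dirichlet_def mult.commute)

lemma dirichlet_add_left: "dirichlet H (\<lambda>x. f x + f' x) g = dirichlet H f g + dirichlet H f' g"
  by (simp add: dirichlet_def sum.distrib[symmetric] algebra_simps split_def)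

lemma unit_potential_add:
  assumes "unit_potential H i j f" "unit_potential H j k f'"
  shows "unit_potential H i k (\<lambda>x. f x + f' x)"
  using assms by (simp add: unit_potential_def dirichlet_add_left)

text \<open>Both differences are half of the symmetric form \<open>dirichlet H f g\<close>, read
  once through \<open>f\<close> and once through \<open>g\<close>.\<close>

lemma unit_potential_reciprocity:
  assumes "unit_potential H i j f" "unit_potential H k l g"
  shows "g i - g j = f k - f l"
  using assms dirichlet_commute[of H f g] by (simp add: unit_potential_def)

text \<open>Reachability is stated along arcs because arcs are symmetric. One existing arc then
  gives every vertex a neighbour, which makes \<open>walk\<close> meaningful.\<close>

locale connected_graph = pair_graph H for H :: "'a pair_pre_digraph" +
  assumes reach: "u \<in> pverts H \<Longrightarrow> v \<in> pverts H \<Longrightarrow> (u, v) \<in> (parcs H)\<^sup>*"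
    and arcs_nonempty: "parcs H \<noteq> {}"
begin

section \<open>Arcs, degrees, Green's identity and harmonic functions\<close>

lemma finite_verts: "finite (pverts H)"
  by (rule pair_finite_verts)

lemma finite_nbrs: "finite (nbrs H x)"
  by (rule finite_subset[OF _ finite_verts]) (auto simp: nbrs_def dest: in_arcsD2)

lemma nbrs_subset: "nbrs H x \<subseteq> pverts H"
  by (auto simp: nbrs_def dest: in_arcsD2)

lemma arc_sym: "(u, v) \<in> parcs H \<Longrightarrow> (v, u) \<in> parcs H"
  using pair_sym_arcs by (auto simp: symmetric_def dest: symD)

lemma parcs_Sigma: "parcs H = Sigma (pverts H) (nbrs H)"
  by (auto simp: nbrs_def dest: in_arcsD1)

lemma sum_parcs: "(\<Sum>(u, v)\<in>parcs H. F u v) = (\<Sum>u\<in>pverts H. \<Sum>v\<in>nbrs H u. F u v)"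
  unfolding parcs_Sigma by (subst sum.Sigma) (auto simp: finite_verts finite_nbrs)

lemma sum_parcs_swap: "(\<Sum>(u, v)\<in>parcs H. F u v) = (\<Sum>(u, v)\<in>parcs H. F v u)"
  by (rule sum.reindex_bij_witness[of _ prod.swap prod.swap]) (auto intro: arc_sym)

lemma sum_deg: "(\<Sum>u\<in>pverts H. real (deg H u) * F u) = (\<Sum>(u, v)\<in>parcs H. F u)"
  by (simp add: sum_parcs deg_def)

text \<open>Sending an arc to its set of ends is two-to-one: without loops, an arc differs from its
  reversal.\<close>

lemma card_parcs: "card (parcs H) = 2 * card (edges H)"
proof -
  let ?f = "\<lambda>(u, v). {u, v}"
  have im: "edges H = ?f ` parcs H"
    by (auto simp: edges_def image_def)
  have fib: "card {p \<in> parcs H. ?f p = e} = 2" if e: "e \<in> edges H" for e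
  proof -
    from e obtain u v where uv: "(u, v) \<in> parcs H" "e = {u, v}"
      by (auto simp: edges_def)
    then have "u \<noteq> v" by (auto dest: no_loops')
    moreover have "{p \<in> parcs H. ?f p = e} = {(u, v), (v, u)}"
      using uv arc_sym by (auto simp: doubleton_eq_iff)
    ultimately show ?thesis by simp
  qed
  have "card (parcs H) = (\<Sum>e\<in>edges H. card {p \<in> parcs H. ?f p = e})"
    unfolding im card_eq_sum
    by (rule sum.group[symmetric]) (auto simp: pair_finite_arcs)
  also have "\<dots> = 2 * card (edges H)"
    using fib by simp
  finally show ?thesis .
qed

lemma edges_pos: "card (edges H) > 0"
  using card_parcs arcs_nonempty pair_finite_arcs by (metis card_0_eq gr0I mult_0_right)

lemma sum_deg_edges: "(\<Sum>u\<in>pverts H. real (deg H u)) = 2 * real (card (edges H))"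
  using sum_deg[of "\<lambda>_. 1"] card_parcs by (simp add: split_def)

lemma ex_nbr: assumes "x \<in> pverts H" shows "nbrs H x \<noteq> {}"
proof -
  obtain u v where uv: "(u, v) \<in> parcs H" using arcs_nonempty by auto
  \<comment> \<open>A path from \<open>x\<close> to \<open>u\<close> either begins with an arc at
    \<open>x\<close> or is empty; in the latter case \<open>v\<close> is a neighbour of
    \<open>x\<close>.\<close>
  have "(x, u) \<in> (parcs H)\<^sup>*" using assms uv by (auto intro: reach in_arcsD1)
  then show ?thesis using uv by (auto simp: nbrs_def elim: converse_rtranclE)
qed

lemma deg_pos: "x \<in> pverts H \<Longrightarrow> deg H x > 0"
  by (simp add: deg_def card_gt_0_iff finite_nbrs ex_nbr)

text \<open>Green's identity: averaging the arc sum of \<open>g u * (f u - f v)\<close> with its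
  reversal produces the product of differences.\<close>

lemma sum_mult_lap: "(\<Sum>x\<in>pverts H. g x * lap H f x) = dirichlet H f g / 2"
proof -
  have *: "(\<Sum>x\<in>pverts H. g x * lap H f x) = (\<Sum>(u, v)\<in>parcs H. g u * (f u - f v))"
    by (simp add: lap_def sum_parcs sum_distrib_left)
  have "(\<Sum>(u, v)\<in>parcs H. g u * (f u - f v)) = (\<Sum>(u, v)\<in>parcs H. g v * (f v - f u))"
    by (rule sum_parcs_swap)
  then have "2 * (\<Sum>(u, v)\<in>parcs H. g u * (f u - f v))
      = (\<Sum>(u, v)\<in>parcs H. g u * (f u - f v)) + (\<Sum>(u, v)\<in>parcs H. g v * (f v - f u))"
    by simp
  also have "\<dots> = dirichlet H f g"
    by (simp add: dirichlet_def sum.distrib[symmetric] split_def algebra_simps)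
  finally show ?thesis using * by simp
qed

lemma sum_laplacian:
  assumes "x \<in> pverts H"
  shows "(\<Sum>y\<in>pverts H. laplacian H x y * f y) = lap H f x"
proof -
  have "(\<Sum>y\<in>pverts H. laplacian H x y * f y)
      = laplacian H x x * f x + (\<Sum>y\<in>pverts H - {x}. laplacian H x y * f y)"
    using assms finite_verts by (simp add: sum.remove)
  also have "(\<Sum>y\<in>pverts H - {x}. laplacian H x y * f y) = (\<Sum>y\<in>nbrs H x. - f y)"
    by (rule sum.mono_neutral_cong_right)
       (use finite_verts nbrs_subset in \<open>auto simp: laplacian_def nbrs_def dest: no_loops'\<close>)
  finally show ?thesis
    by (simp add: lap_def laplacian_def sum_subtractf deg_def sum_negf)
qed

lemma laplacian_sym: "laplacian H x y = laplacian H y x"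
  by (auto simp: laplacian_def intro: arc_sym)

lemma sum_lap: "(\<Sum>x\<in>pverts H. lap H f x) = 0"
  using sum_mult_lap[of "\<lambda>_. 1" f] by (simp add: dirichlet_def)

text \<open>Green's identity with \<open>g = f\<close> makes the energy a vanishing sum of squares,
  so \<open>f\<close> agrees across each arc and hence along paths.\<close>

lemma harmonic_constant:
  assumes "\<And>x. x \<in> pverts H \<Longrightarrow> lap H f x = 0" and u: "u \<in> pverts H" and v: "v \<in> pverts H"
  shows "f u = f v"
proof -
  have "dirichlet H f f = 0"
    using sum_mult_lap[of f f] assms(1) by simp
  then have "\<forall>p\<in>parcs H. (\<lambda>(u, v). (f u - f v) * (f u - f v)) p = 0"
    unfolding dirichlet_def by (subst (asm) sum_nonneg_eq_0_iff) (auto simp: pair_finite_arcs)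
  then have arc: "f a = f b" if "(a, b) \<in> parcs H" for a b
    using that by auto
  from reach[OF u v] show ?thesis
    by induction (auto dest: arc)
qed

section \<open>Hitting times\<close>

lemma hit_prob_0: "hit_prob H i j 0 = (if i = j then 1 else 0)"
  by (simp add: hit_prob_def)

lemma hit_prob_Suc:
  assumes "i \<in> pverts H"
  shows "hit_prob H i j (Suc t) = (if i = j then 0 else (\<Sum>w\<in>nbrs H i. hit_prob H w j t) / deg H i)"
proof -
  \<comment> \<open>Prepending the start shifts the event by one step; if the walk starts at
    \<open>j\<close>, time 0 rules out a later first visit.\<close>
  have "(\<lambda>xs. i # xs) -` {xs. xs ! Suc t = j \<and> (\<forall>s<Suc t. xs ! s \<noteq> j)} =
      (if i = j then {} else {xs. xs ! t = j \<and> (\<forall>s<t. xs ! s \<noteq> j)})"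
    by (auto simp: less_Suc_eq_0_disj) 
  then show ?thesis
    unfolding hit_prob_def walk.simps
    by (subst measure_bind_pmf_of_set) (auto simp: finite_nbrs ex_nbr assms deg_def)
qed

lemma hit_prob_nonneg: "hit_prob H i j t \<ge> 0"
  by (simp add: hit_prob_def)

text \<open>This is \<open>P(T > t)\<close> for the hitting time \<open>T\<close> of
  \<open>j\<close>. The start comes last, so that \<open>survival j t\<close> is a function on
  vertices.\<close>

definition survival :: "'a \<Rightarrow> nat \<Rightarrow> 'a \<Rightarrow> real" where
  "survival j t i = 1 - (\<Sum>s\<le>t. hit_prob H i j s)"

lemma survival_0: "survival j 0 i = (if i = j then 0 else 1)"
  by (simp add: survival_def hit_prob_0)

lemma survival_Suc:
  assumes "i \<in> pverts H"
  shows "survival j (Suc t) i = (if i = j then 0 else (\<Sum>w\<in>nbrs H i. survival j t w) / deg H i)"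
proof -
  have "survival j (Suc t) i = 1 - hit_prob H i j 0 - (\<Sum>s\<le>t. hit_prob H i j (Suc s))"
    by (simp only: survival_def sum.atMost_Suc_shift diff_diff_add)
  also have "(\<Sum>s\<le>t. hit_prob H i j (Suc s)) =
      (if i = j then 0 else (\<Sum>w\<in>nbrs H i. \<Sum>s\<le>t. hit_prob H w j s) / deg H i)"
    using assms by (subst sum.swap) (simp add: hit_prob_Suc sum_divide_distrib)
  finally have "survival j (Suc t) i = 1 - hit_prob H i j 0 -
      (if i = j then 0 else (\<Sum>w\<in>nbrs H i. \<Sum>s\<le>t. hit_prob H w j s) / deg H i)" .
  then show ?thesis
    using deg_pos[OF assms]
    by (cases "i = j") (simp_all add: hit_prob_0 survival_def[of _ t] sum_subtractf diff_divide_distrib flip: deg_def)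
qed

lemma survival_self: "j \<in> pverts H \<Longrightarrow> survival j t j = 0"
  by (cases t) (simp_all add: survival_0 survival_Suc)

text \<open>The recursion averages over neighbours, so the sign propagates from
  \<open>t = 0\<close>.\<close>

lemma survival_nonneg: "i \<in> pverts H \<Longrightarrow> survival j t i \<ge> 0"
proof (induction t arbitrary: i)
  case (Suc t)
  then show ?case
    using nbrs_subset by (auto simp: survival_Suc intro!: divide_nonneg_nonneg sum_nonneg)
qed (simp add: survival_0)

text \<open>
  As in Kac's formula: reversibility makes the mass \<open>\<Sum> d\<^sub>i u\<^sub>t(i)\<close> drop at step \<open>t\<close> exactly by the
  surviving mass on the neighbours of the target, so the latter is summable in \<open>t\<close>.
\<close>

lemma survival_mass_drop:
  assumes j: "j \<in> pverts H"
  shows "(\<Sum>i\<in>pverts H. deg H i * survival j (Suc t) i) + (\<Sum>w\<in>nbrs H j. survival j t w) =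
    (\<Sum>i\<in>pverts H. deg H i * survival j t i)"
proof -
  have "(\<Sum>i\<in>pverts H. deg H i * survival j t i) = (\<Sum>(i, w)\<in>parcs H. survival j t w)"
    using sum_deg[of "survival j t"] sum_parcs_swap[of "\<lambda>i w. survival j t i"] by simp
  also have "\<dots> = (\<Sum>w\<in>nbrs H j. survival j t w) + (\<Sum>i\<in>pverts H - {j}. \<Sum>w\<in>nbrs H i. survival j t w)"
    using j finite_verts by (simp add: sum_parcs sum.remove)
  also have "(\<Sum>i\<in>pverts H - {j}. \<Sum>w\<in>nbrs H i. survival j t w) =
      (\<Sum>i\<in>pverts H - {j}. deg H i * survival j (Suc t) i)"
    by (intro sum.cong refl) (auto simp: survival_Suc dest: deg_pos)
  also have "\<dots> = (\<Sum>i\<in>pverts H. deg H i * survival j (Suc t) i)"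
    using j finite_verts by (simp add: sum.remove[of _ j] survival_self)
  finally show ?thesis by simp
qed

text \<open>The mass drops telescope, so the partial sums over all neighbours of \<open>j\<close>
  are bounded by the initial mass.\<close>

lemma summable_survival_nbr:
  assumes j: "j \<in> pverts H" and w: "w \<in> nbrs H j"
  shows "summable (\<lambda>t. survival j t w)"
proof (rule summableI_nonneg_bounded)
  let ?M = "\<lambda>t. \<Sum>i\<in>pverts H. deg H i * survival j t i"
  show "0 \<le> survival j t w" for t
    using w nbrs_subset by (auto intro: survival_nonneg)
  have M: "(\<Sum>t<N. \<Sum>w\<in>nbrs H j. survival j t w) = ?M 0 - ?M N" for N
  proof (induction N)
    case (Suc N)
    then show ?case using survival_mass_drop[OF j, of N] by simp
  qed simp
  have nn: "?M N \<ge> 0" for N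
    by (intro sum_nonneg mult_nonneg_nonneg) (auto intro: survival_nonneg)
  show "(\<Sum>t<N. survival j t w) \<le> ?M 0" for N
  proof -
    have "(\<Sum>t<N. survival j t w) \<le> (\<Sum>t<N. \<Sum>w\<in>nbrs H j. survival j t w)"
      using w nbrs_subset by (intro sum_mono member_le_sum) (auto simp: finite_nbrs intro: survival_nonneg)
    then show ?thesis using M[of N] nn[of N] by simp
  qed
qed

text \<open>Summability spreads along a path from \<open>j\<close>: for \<open>v \<noteq> j\<close>
  the recursion at \<open>v\<close> bounds survival at each neighbour by \<open>deg H v\<close>
  times survival at \<open>v\<close> one step later. At \<open>v = j\<close> that recursion gives
  nothing, and the mass bound takes over.\<close>

lemma summable_survival:
  assumes j: "j \<in> pverts H" and i: "i \<in> pverts H"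
  shows "summable (\<lambda>t. survival j t i)"
  using reach[OF j i]
proof induction
  case base
  then show ?case using j by (simp add: survival_self)
next
  case (step v w)
  have v: "v \<in> pverts H" and w: "w \<in> pverts H" "w \<in> nbrs H v"
    using step by (auto simp: nbrs_def dest: in_arcsD1 in_arcsD2)
  show ?case
  proof (cases "v = j")
    case True
    then show ?thesis using w j summable_survival_nbr by simp
  next
    case False
    have le: "survival j t w \<le> deg H v * survival j (Suc t) v" for t
    proof -
      have "survival j t w \<le> (\<Sum>w\<in>nbrs H v. survival j t w)"
        using w nbrs_subset by (intro member_le_sum) (auto simp: finite_nbrs intro: survival_nonneg)
      then show ?thesis using False v deg_pos[OF v] by (simp add: survival_Suc)
    qed
    have "summable (\<lambda>t. deg H v * survival j (Suc t) v)"
      by (intro summable_mult iffD2[OF summable_Suc_iff[of "\<lambda>t. survival j t v"]] step.IH)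
    then show ?thesis
      by (rule summable_comparison_test'[where N = 0]) (simp add: le survival_nonneg w)
  qed
qed

text \<open>Terms of a summable series tend to 0, so survival dies out and the walk almost surely
  hits \<open>j\<close>.\<close>

lemma hit_prob_sums_1:
  assumes "j \<in> pverts H" "i \<in> pverts H"
  shows "hit_prob H i j sums 1"
proof -
  have "(\<lambda>t. 1 - survival j t i) \<longlonglongrightarrow> 1 - 0"
    by (intro tendsto_intros summable_LIMSEQ_zero summable_survival assms)
  then show ?thesis
    by (simp add: survival_def sums_def_le)
qed

lemma summable_hitting:
  assumes "j \<in> pverts H" "i \<in> pverts H"
  shows "summable (\<lambda>t. real t * hit_prob H i j t)"
proof -
  \<comment> \<open>Summation by parts: \<open>E(T; T \<le> N)\<close> is the sum of
    \<open>P(T > t)\<close> over \<open>t < N\<close>, minus \<open>N P(T > N)\<close>.\<close>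
  have *: "(\<Sum>t\<le>N. real t * hit_prob H i j t) = (\<Sum>t<N. survival j t i) - N * survival j N i" for N
    by (induction N) (simp_all add: survival_def algebra_simps)
  show ?thesis
  proof (rule summableI_nonneg_bounded)
    show "0 \<le> real t * hit_prob H i j t" for t
      by (simp add: hit_prob_nonneg)
    fix N
    have "(\<Sum>t<N. real t * hit_prob H i j t) \<le> (\<Sum>t\<le>N. real t * hit_prob H i j t)"
      by (intro sum_mono2) (auto simp: hit_prob_nonneg)
    also have "\<dots> \<le> (\<Sum>t<N. survival j t i)"
      using assms by (simp add: * survival_nonneg)
    also have "\<dots> \<le> (\<Sum>t. survival j t i)"
      using assms by (intro sum_le_suminf summable_survival) (auto simp: survival_nonneg)
    finally show "(\<Sum>t<N. real t * hit_prob H i j t) \<le> (\<Sum>t. survival j t i)" .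
  qed
qed

lemma hitting_time_self: assumes "j \<in> pverts H" shows "hitting_time H j j = 0"
proof -
  have "real t * hit_prob H j j t = 0" for t
    using assms by (cases t) (simp_all add: hit_prob_Suc)
  then show ?thesis by (simp only: hitting_time_def suminf_zero)
qed

lemma hitting_time_step:
  assumes j: "j \<in> pverts H" and i: "i \<in> pverts H" and "i \<noteq> j"
  shows "hitting_time H i j = 1 + (\<Sum>w\<in>nbrs H i. hitting_time H w j) / deg H i"
proof -
  have w: "w \<in> pverts H" if "w \<in> nbrs H i" for w using that nbrs_subset by auto
  \<comment> \<open>Hitting at time \<open>t + 1\<close> has weight \<open>t + 1\<close>; the extra
    1 sums to the total probability 1.\<close>
  have "(\<lambda>t. real t * hit_prob H w j t + hit_prob H w j t) sums (hitting_time H w j + 1)"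
    if "w \<in> nbrs H i" for w
    unfolding hitting_time_def
    by (intro sums_add summable_sums summable_hitting hit_prob_sums_1 j w that)
  then have "(\<lambda>t. (\<Sum>w\<in>nbrs H i. real t * hit_prob H w j t + hit_prob H w j t) / deg H i) sums
      ((\<Sum>w\<in>nbrs H i. hitting_time H w j + 1) / deg H i)"
    by (intro sums_divide sums_sum)
  also have "(\<lambda>t. (\<Sum>w\<in>nbrs H i. real t * hit_prob H w j t + hit_prob H w j t) / deg H i) =
      (\<lambda>t. real (Suc t) * hit_prob H i j (Suc t))"
    using assms by (simp add: hit_prob_Suc fun_eq_iff sum_distrib_left algebra_simps sum.distrib)
  \<comment> \<open>Undoing the index shift adds the term at \<open>t = 0\<close>, which is 0 by its
    factor \<open>t\<close>.\<close>
  finally have "(\<lambda>t. real t * hit_prob H i j t) sums ((\<Sum>w\<in>nbrs H i. hitting_time H w j + 1) / deg H i)"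
    by (subst (asm) sums_Suc_iff) simp
  then have "hitting_time H i j = (\<Sum>w\<in>nbrs H i. hitting_time H w j + 1) / deg H i"
    unfolding hitting_time_def by (simp add: sums_iff)
  then show ?thesis
    using deg_pos[OF i] by (simp add: sum.distrib field_simps flip: deg_def)
qed

text \<open>Away from \<open>j\<close> this is the one-step equation. At \<open>j\<close>, where
  that equation fails, the value is forced: Laplacian values sum to 0 and degrees to
  \<open>2m\<close>.\<close>

lemma lap_hitting_time:
  assumes j: "j \<in> pverts H" and i: "i \<in> pverts H"
  shows "lap H (\<lambda>i. hitting_time H i j) i = real (deg H i) - 2 * real (card (edges H)) * unit_vec j i"
proof -
  let ?h = "\<lambda>i. hitting_time H i j"
  have *: "lap H ?h i = deg H i" if i: "i \<in> pverts H" and "i \<noteq> j" for i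
    using hitting_time_step[OF j that] deg_pos[OF i]
    by (simp add: lap_def sum_subtractf field_simps flip: deg_def)
  have "0 = lap H ?h j + (\<Sum>x\<in>pverts H - {j}. lap H ?h x)"
    using sum_lap[of ?h] j finite_verts by (simp add: sum.remove)
  also have "(\<Sum>x\<in>pverts H - {j}. lap H ?h x) = (\<Sum>x\<in>pverts H - {j}. real (deg H x))"
    by (intro sum.cong) (auto simp: *)
  also have "\<dots> = 2 * real (card (edges H)) - real (deg H j)"
    using sum_deg_edges j finite_verts by (simp add: sum.remove[of _ j])
  finally have "lap H ?h j = real (deg H j) - 2 * real (card (edges H))" by simp
  with * i show ?thesis by (auto simp: unit_vec_def)
qed

end

section \<open>The pseudoinverse and effective resistance\<close>

lemma mat_times_assoc:
  "mat_times V (mat_times V A B) C = mat_times V A (mat_times V B C)"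
proof (intro ext)
  fix i j
  have "mat_times V (mat_times V A B) C i j = (\<Sum>k\<in>V. \<Sum>l\<in>V. A i l * B l k * C k j)"
    by (simp add: mat_times_def sum_distrib_right)
  also have "\<dots> = (\<Sum>l\<in>V. \<Sum>k\<in>V. A i l * B l k * C k j)"
    by (rule sum.swap)
  finally show "mat_times V (mat_times V A B) C i j = mat_times V A (mat_times V B C) i j"
    by (simp add: mat_times_def sum_distrib_left mult.assoc)
qed

lemma mat_times_cong:
  assumes "\<And>k. k \<in> V \<Longrightarrow> A i k = A' i k" "\<And>k. k \<in> V \<Longrightarrow> B k j = B' k j"
  shows "mat_times V A B i j = mat_times V A' B' i j"
  using assms by (auto simp: mat_times_def)

lemma mat_times_transpose:
  "mat_times V (\<lambda>i j. A j i) (\<lambda>i j. B j i) i j = mat_times V B A j i"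
  by (simp add: mat_times_def mult.commute)

text \<open>
  The usual computation \<open>P = PAP = PAQAP = \<dots> = Q\<close>, carried out in two halves: both \<open>AP = AQ\<close> and
  \<open>PA = QA\<close> follow by transposing.
\<close>

lemma pseudoinverse_unique:
  assumes P: "is_pseudoinverse V A P" and Q: "is_pseudoinverse V A Q" and i: "i \<in> V" and j: "j \<in> V"
  shows "P i j = Q i j"
proof -
  note D = is_pseudoinverse_def
  have AP: "mat_times V A P i j = mat_times V A Q i j" if i: "i \<in> V" and j: "j \<in> V" for i j
  proof -
    have "mat_times V A P i j = mat_times V (mat_times V (mat_times V A Q) A) P i j"
      using Q i j by - (rule mat_times_cong, auto simp: D)
    also have "\<dots> = mat_times V (mat_times V A Q) (mat_times V A P) i j"
      by (simp add: mat_times_assoc)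
    also have "\<dots> = mat_times V (\<lambda>i j. mat_times V A Q j i) (\<lambda>i j. mat_times V A P j i) i j"
      using P Q i j by - (rule mat_times_cong, auto simp: D)
    also have "\<dots> = mat_times V (mat_times V A P) (mat_times V A Q) j i"
      by (rule mat_times_transpose)
    also have "\<dots> = mat_times V (mat_times V (mat_times V A P) A) Q j i"
      by (simp add: mat_times_assoc)
    also have "\<dots> = mat_times V A Q j i"
      using P i j by - (rule mat_times_cong, auto simp: D)
    finally show ?thesis using Q i j by (simp add: D)
  qed
  have PA: "mat_times V P A i j = mat_times V Q A i j" if i: "i \<in> V" and j: "j \<in> V" for i j
  proof -
    have "mat_times V P A i j = mat_times V P (mat_times V (mat_times V A Q) A) i j"
      using Q i j by - (rule mat_times_cong, auto simp: D)
    also have "\<dots> = mat_times V (mat_times V P A) (mat_times V Q A) i j"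
      by (simp add: mat_times_assoc)
    also have "\<dots> = mat_times V (\<lambda>i j. mat_times V P A j i) (\<lambda>i j. mat_times V Q A j i) i j"
      using P Q i j by - (rule mat_times_cong, auto simp: D)
    also have "\<dots> = mat_times V (mat_times V Q A) (mat_times V P A) j i"
      by (rule mat_times_transpose)
    also have "\<dots> = mat_times V Q (mat_times V (mat_times V A P) A) j i"
      by (simp add: mat_times_assoc)
    also have "\<dots> = mat_times V Q A j i"
      using P i j by - (rule mat_times_cong, auto simp: D)
    finally show ?thesis using Q i j by (simp add: D)
  qed
  have "P i j = mat_times V (mat_times V P A) P i j"
    using P i j by (simp add: D)
  also have "\<dots> = mat_times V (mat_times V Q A) P i j"
    using PA i by - (rule mat_times_cong, auto)
  also have "\<dots> = mat_times V Q (mat_times V A P) i j"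
    by (simp add: mat_times_assoc)
  also have "\<dots> = mat_times V Q (mat_times V A Q) i j"
    using AP j by - (rule mat_times_cong, auto)
  also have "\<dots> = mat_times V (mat_times V Q A) Q i j"
    by (simp add: mat_times_assoc)
  also have "\<dots> = Q i j"
    using Q i j by (simp add: D)
  finally show ?thesis .
qed

text \<open>The Penrose conditions only involve entries with both indices in \<open>V\<close>, so
  \<open>P\<close> may be set to zero elsewhere; the result is the unique function that the definite
  description selects.\<close>

lemma is_pseudoinverse_pseudoinverse:
  assumes "is_pseudoinverse V A P"
  shows "is_pseudoinverse V A (pseudoinverse V A)"
proof -
  define P' where "P' = (\<lambda>i j. if i \<in> V \<and> j \<in> V then P i j else 0)"
  have PA: "mat_times V P' A i j = mat_times V P A i j" if "i \<in> V" for i j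
    using that by (simp add: mat_times_def P'_def)
  have AP: "mat_times V A P' i j = mat_times V A P i j" if "j \<in> V" for i j
    using that by (simp add: mat_times_def P'_def)
  have PAP: "mat_times V (mat_times V P' A) P' i j = mat_times V (mat_times V P A) P i j"
    if "i \<in> V" "j \<in> V" for i j
    using that by - (rule mat_times_cong, simp_all add: PA, simp add: P'_def)
  have APA: "mat_times V (mat_times V A P') A i j = mat_times V (mat_times V A P) A i j" for i j
    by - (rule mat_times_cong, auto simp: AP)
  have ps: "is_pseudoinverse V A P'"
    using assms by (simp add: is_pseudoinverse_def PA AP PAP APA) (simp add: P'_def)
  have "\<exists>!P. is_pseudoinverse V A P \<and> (\<forall>i j. i \<notin> V \<or> j \<notin> V \<longrightarrow> P i j = 0)"
  proof (rule ex1I)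
    show "is_pseudoinverse V A P' \<and> (\<forall>i j. i \<notin> V \<or> j \<notin> V \<longrightarrow> P' i j = 0)"
      using ps by (auto simp: P'_def)
    fix Q assume Q: "is_pseudoinverse V A Q \<and> (\<forall>i j. i \<notin> V \<or> j \<notin> V \<longrightarrow> Q i j = 0)"
    show "Q = P'"
    proof (intro ext)
      fix i j
      show "Q i j = P' i j"
        using Q pseudoinverse_unique[of V A Q P' i j] ps by (cases "i \<in> V \<and> j \<in> V") (auto simp: P'_def)
    qed
  qed
  from theI'[OF this] show ?thesis
    unfolding pseudoinverse_def by blast
qed

context connected_graph
begin

section \<open>Linearity of the Laplacian and the strong form of unit potentials\<close>

lemma lap_diff: "lap H (\<lambda>x. f x - g x) x = lap H f x - lap H g x"
  unfolding lap_def sum_subtractf[symmetric] by (intro sum.cong) auto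

lemma lap_add_const: "lap H (\<lambda>x. f x + c) x = lap H f x"
  by (simp add: lap_def)

lemma lap_cmult: "lap H (\<lambda>x. c * f x) x = c * lap H f x"
  by (simp add: lap_def sum_distrib_left right_diff_distrib)

lemma lap_sum: "lap H (\<lambda>x. \<Sum>k\<in>K. F k x) x = (\<Sum>k\<in>K. lap H (F k) x)"
  unfolding lap_def sum_subtractf[symmetric] by (rule sum.swap)

lemma unit_vec_commute: "unit_vec i j = unit_vec j i"
  by (simp add: unit_vec_def)

lemma sum_mult_unit_vec:
  assumes "x \<in> pverts H"
  shows "(\<Sum>y\<in>pverts H. f y * unit_vec x y) = f x"
proof -
  have "(\<Sum>y\<in>pverts H. f y * unit_vec x y) = (\<Sum>y\<in>pverts H. if y = x then f y else 0)"
    by (intro sum.cong) (auto simp: unit_vec_def)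
  then show ?thesis using assms finite_verts by simp
qed

text \<open>Green's identity gives one direction by pairing with an arbitrary \<open>g\<close>, the
  other by testing with the indicator of \<open>x\<close>.\<close>

lemma unit_potential_iff_lap:
  assumes i: "i \<in> pverts H" and j: "j \<in> pverts H"
  shows "unit_potential H i j f \<longleftrightarrow> (\<forall>x\<in>pverts H. lap H f x = unit_vec i x - unit_vec j x)"
proof
  have sub: "(\<Sum>x\<in>pverts H. g x * (unit_vec i x - unit_vec j x)) = g i - g j" for g
    using i j by (simp add: right_diff_distrib sum_subtractf sum_mult_unit_vec)
  {
    assume "\<forall>x\<in>pverts H. lap H f x = unit_vec i x - unit_vec j x"
    then have "dirichlet H f g / 2 = g i - g j" for g
      unfolding sum_mult_lap[symmetric] sub[symmetric] by simp
    then show "unit_potential H i j f"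
      by (simp add: unit_potential_def field_simps)
  }
  {
    assume f: "unit_potential H i j f"
    show "\<forall>x\<in>pverts H. lap H f x = unit_vec i x - unit_vec j x"
    proof
      fix x assume x: "x \<in> pverts H"
      have "lap H f x = (\<Sum>y\<in>pverts H. unit_vec x y * lap H f y)"
        using x sum_mult_unit_vec[of x "lap H f"] by (simp add: mult.commute)
      then show "lap H f x = unit_vec i x - unit_vec j x"
        using f by (auto simp: sum_mult_lap unit_potential_def unit_vec_def)
    qed
  }
qed

text \<open>The degree terms of the two Laplacians cancel in the difference, leaving
  \<open>2m (e_i - e_j)\<close>.\<close>

lemma unit_potential_hitting_time:
  assumes i: "i \<in> pverts H" and j: "j \<in> pverts H"
  shows "unit_potential H i j (\<lambda>x. (hitting_time H x j - hitting_time H x i) / (2 * card (edges H)))"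
proof -
  have "lap H (\<lambda>x. 1 / (2 * card (edges H)) * (hitting_time H x j - hitting_time H x i)) x =
      unit_vec i x - unit_vec j x" if "x \<in> pverts H" for x
    using assms that edges_pos unfolding lap_cmult lap_diff
    by (simp add: lap_hitting_time field_simps)
  then show ?thesis
    by (simp add: unit_potential_iff_lap assms)
qed

text \<open>
  The columns of the pseudoinverse are the mean-zero solutions of \<open>L g\<^sub>j = e\<^sub>j - 1/|V|\<close>, obtained by
  averaging unit potentials. Then \<open>LP = I - J/|V|\<close>, and \<open>P\<close> is symmetric because \<open>P = P\<^sup>TLP\<close>.
\<close>

lemma ex_pseudoinverse: "\<exists>P. is_pseudoinverse (pverts H) (laplacian H) P"
proof -
  let ?V = "pverts H" and ?n = "real (card (pverts H))" and ?L = "laplacian H"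
  obtain u v where "(u, v) \<in> parcs H" using arcs_nonempty by auto
  then have n: "?n > 0" using finite_verts by (auto simp: card_gt_0_iff dest: in_arcsD1)
  define F where "F = (\<lambda>j i x. (hitting_time H x i - hitting_time H x j) / (2 * card (edges H)))"
  have F: "unit_potential H j i (F j i)" if "j \<in> ?V" "i \<in> ?V" for i j
    unfolding F_def using that by (rule unit_potential_hitting_time)
  define g where "g = (\<lambda>j x. 1 / ?n * (\<Sum>i\<in>?V. F j i x))"
  define P where "P = (\<lambda>x j. g j x + - (\<Sum>y\<in>?V. g j y) / ?n)"
  have sum_vec: "(\<Sum>i\<in>?V. unit_vec i x) = 1" if "x \<in> ?V" for x
    using that finite_verts by (simp add: unit_vec_def)
  have lapg: "lap H (g j) x = unit_vec j x - 1 / ?n" if "j \<in> ?V" "x \<in> ?V" for j x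
  proof -
    have "lap H (g j) x = 1 / ?n * (\<Sum>i\<in>?V. unit_vec j x - unit_vec i x)"
      unfolding g_def lap_cmult lap_sum
      using F that by (intro arg_cong2[where f = "(*)"] sum.cong refl) (auto simp: unit_potential_iff_lap)
    then show ?thesis
      using n that by (auto simp: sum_subtractf sum_vec right_diff_distrib)
  qed
  have LP: "mat_times ?V ?L P x j = unit_vec j x - 1 / ?n" if "j \<in> ?V" "x \<in> ?V" for j x
  proof -
    have "mat_times ?V ?L P x j = lap H (\<lambda>x. g j x + - (\<Sum>y\<in>?V. g j y) / ?n) x"
      unfolding mat_times_def P_def using that(2) by (rule sum_laplacian)
    then show ?thesis using that by (simp only: lap_add_const lapg)
  qed
  have LP_sym: "mat_times ?V ?L P x j = mat_times ?V ?L P j x" if "j \<in> ?V" "x \<in> ?V" for j x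
    using that by (simp only: LP unit_vec_commute)
  have mean: "(\<Sum>x\<in>?V. P x j) = 0" for j
    using n by (simp add: P_def sum.distrib sum_subtractf)
  have proj: "(\<Sum>k\<in>?V. (unit_vec i k - 1 / ?n) * f k) = f i - (\<Sum>k\<in>?V. f k) / ?n"
    if "i \<in> ?V" for i f
    using sum_mult_unit_vec[OF that, of f]
    by (simp add: left_diff_distrib sum_subtractf sum_divide_distrib mult.commute[of "unit_vec _ _"])
  \<comment> \<open>The \<open>1 / ?n\<close> part of \<open>LP\<close> only sees column sums of
    \<open>P\<close>, which vanish; what remains is the transpose of \<open>P\<close>.\<close>
  have PLP: "mat_times ?V (\<lambda>i j. P j i) (mat_times ?V ?L P) i j = P j i" if "i \<in> ?V" "j \<in> ?V" for i j
  proof -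
    have "mat_times ?V (\<lambda>i j. P j i) (mat_times ?V ?L P) i j = (\<Sum>k\<in>?V. (unit_vec j k - 1 / ?n) * P k i)"
      unfolding mat_times_def[of _ "\<lambda>i j. P j i"] using that
      by (intro sum.cong refl) (simp only: LP mult.commute)
    then show ?thesis
      using that by (simp add: proj mean)
  qed
  have P_sym: "P i j = P j i" if "i \<in> ?V" "j \<in> ?V" for i j
  proof -
    have "P i j = mat_times ?V (\<lambda>i j. P j i) (mat_times ?V ?L P) j i"
      using PLP that by simp
    also have "\<dots> = mat_times ?V (\<lambda>i j. mat_times ?V ?L P j i) (\<lambda>i j. P i j) i j"
      using mat_times_transpose[of ?V "mat_times ?V ?L P" "\<lambda>i j. P j i" i j] by simp
    also have "(\<lambda>i j. mat_times ?V ?L P j i) = mat_times ?V (\<lambda>i j. P j i) ?L"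
      unfolding mat_times_def by (intro ext sum.cong refl) (metis laplacian_sym mult.commute)
    finally show ?thesis
      using PLP that by (simp add: mat_times_assoc)
  qed
  have PL: "mat_times ?V P ?L i j = mat_times ?V ?L P j i" if "i \<in> ?V" "j \<in> ?V" for i j
    unfolding mat_times_def
    using that by (intro sum.cong refl) (metis P_sym laplacian_sym mult.commute)
  have 1: "mat_times ?V (mat_times ?V ?L P) ?L i j = ?L i j" if "i \<in> ?V" "j \<in> ?V" for i j
  proof -
    have "mat_times ?V (mat_times ?V ?L P) ?L i j = (\<Sum>k\<in>?V. (unit_vec i k - 1 / ?n) * ?L k j)"
      unfolding mat_times_def[of _ "mat_times ?V ?L P"]
    proof (intro sum.cong refl)
      show "mat_times ?V ?L P i k * ?L k j = (unit_vec i k - 1 / ?n) * ?L k j" if "k \<in> ?V" for k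
        using \<open>i \<in> ?V\<close> that by (simp only: LP unit_vec_commute)
    qed
    \<comment> \<open>The \<open>1 / ?n\<close> part contributes column sums of \<open>L\<close>. By
      symmetry these are row sums, that is, \<open>L\<close> applied to the constant 1.\<close>
    also have "\<dots> = ?L i j - (\<Sum>k\<in>?V. ?L j k * 1) / ?n"
      using that laplacian_sym by (subst proj) (auto intro!: sum.cong)
    also have "(\<Sum>k\<in>?V. ?L j k * 1) = 0"
      using that by (subst sum_laplacian) (auto simp: lap_def)
    finally show ?thesis by simp
  qed
  have 2: "mat_times ?V (mat_times ?V P ?L) P i j = P i j" if "i \<in> ?V" "j \<in> ?V" for i j
  proof -
    have "mat_times ?V (mat_times ?V P ?L) P i j = mat_times ?V (\<lambda>i j. P j i) (mat_times ?V ?L P) i j"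
      unfolding mat_times_assoc using that P_sym by - (rule mat_times_cong, auto)
    then show ?thesis using PLP P_sym that by simp
  qed
  show ?thesis
    unfolding is_pseudoinverse_def
    using 1 2 PL LP_sym by (intro exI[of _ P]) auto
qed

text \<open>With \<open>Lf = e_i - e_j\<close> and \<open>L\<close> symmetric,
  \<open>r = f^T L L^+ L f = f^T L f = f i - f j\<close>.\<close>

lemma eff_res_unit_potential:
  assumes i: "i \<in> pverts H" and j: "j \<in> pverts H" and f: "unit_potential H i j f"
  shows "eff_res H i j = f i - f j"
proof -
  let ?V = "pverts H" and ?L = "laplacian H"
  define P where "P = pseudoinverse ?V ?L"
  have P: "is_pseudoinverse ?V ?L P"
    unfolding P_def using ex_pseudoinverse is_pseudoinverse_pseudoinverse by blast
  \<comment> \<open>\<open>f\<close> is written as a matrix with all columns equal, so that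
    associativity of \<open>mat_times\<close> applies to it.\<close>
  let ?F = "\<lambda>k _. f k"
  define W where "W = mat_times ?V P (mat_times ?V ?L ?F)"
  have LF: "mat_times ?V ?L ?F x i = unit_vec i x - unit_vec j x" if "x \<in> ?V" for x
    using f i j that by (simp add: mat_times_def unit_potential_iff_lap sum_laplacian)
  have "eff_res H i j = (\<Sum>x\<in>?V. mat_times ?V ?L ?F x i * W x i)"
    unfolding eff_res_def P_def[symmetric] W_def mat_times_def[of ?V P] sum_distrib_left
    by (intro sum.cong refl) (simp add: LF mult_ac)
  also have "\<dots> = (\<Sum>x\<in>?V. \<Sum>k\<in>?V. f k * (?L k x * W x i))"
    unfolding mat_times_def[of ?V ?L] sum_distrib_right
  proof (intro sum.cong refl)
    show "?L x k * f k * W x i = f k * (?L k x * W x i)" for x k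
      using laplacian_sym[of x k] by simp
  qed
  also have "\<dots> = (\<Sum>k\<in>?V. f k * mat_times ?V ?L W k i)"
    unfolding mat_times_def[of ?V ?L W] sum_distrib_left by (rule sum.swap)
  also have "mat_times ?V ?L W = mat_times ?V (mat_times ?V (mat_times ?V ?L P) ?L) ?F"
    by (simp add: W_def mat_times_assoc)
  also have "(\<Sum>k\<in>?V. f k * \<dots> k i) = (\<Sum>k\<in>?V. f k * mat_times ?V ?L ?F k i)"
    using P unfolding is_pseudoinverse_def
    by (intro sum.cong refl arg_cong2[where f = "(*)"] mat_times_cong) auto
  also have "\<dots> = (\<Sum>k\<in>?V. f k * lap H f k)"
    by (simp add: mat_times_def sum_laplacian)
  also have "\<dots> = f i - f j"
    using f by (simp add: sum_mult_lap unit_potential_def)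
  finally show ?thesis .
qed

text \<open>The resistance is the drop of the hitting-time potential between its ends, where the
  diagonal hitting times vanish.\<close>

lemma eff_res_commute_time:
  assumes i: "i \<in> pverts H" and j: "j \<in> pverts H"
  shows "2 * card (edges H) * eff_res H i j = hitting_time H i j + hitting_time H j i"
  using eff_res_unit_potential[OF i j unit_potential_hitting_time[OF i j]] edges_pos
  by (simp add: hitting_time_self assms field_simps)

lemma eff_res_self: "eff_res H i i = 0"
  by (simp add: eff_res_def)

lemma eff_res_commute: "eff_res H i j = eff_res H j i"
  unfolding eff_res_def by (intro sum.cong refl) (simp add: left_diff_distrib right_diff_distrib)

section \<open>Kemeny's constant\<close>

text \<open>The stationary average of \<open>L h_j = d - 2m e_j\<close> is
  \<open>d - 2m \<pi> = 0\<close>. The mean hitting time is thus harmonic in the starting vertex,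
  hence constant, and the definite description denotes it.\<close>

lemma kemeny_start:
  assumes i: "i \<in> pverts H"
  shows "kemeny H = (\<Sum>j\<in>pverts H. stationary H j * hitting_time H i j)"
proof -
  let ?k = "\<lambda>i. \<Sum>j\<in>pverts H. stationary H j * hitting_time H i j"
  have "lap H ?k x = 0" if x: "x \<in> pverts H" for x
  proof -
    have "lap H ?k x = (\<Sum>j\<in>pverts H. stationary H j *
        (real (deg H x) - 2 * real (card (edges H)) * unit_vec j x))"
      using x by (simp add: lap_sum lap_cmult lap_hitting_time)
    also have "\<dots> = real (deg H x) * (\<Sum>j\<in>pverts H. stationary H j)
        - 2 * real (card (edges H)) * (\<Sum>j\<in>pverts H. stationary H j * unit_vec j x)"
      by (simp add: right_diff_distrib sum_subtractf sum_distrib_left mult_ac)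
    also have "(\<Sum>j\<in>pverts H. stationary H j * unit_vec j x) = stationary H x"
      using sum_mult_unit_vec[OF x, of "stationary H"] by (simp only: unit_vec_commute)
    also have "(\<Sum>j\<in>pverts H. stationary H j) = 1"
      using sum_deg_edges edges_pos by (simp add: stationary_def flip: sum_divide_distrib)
    finally show ?thesis
      using edges_pos by (simp add: stationary_def)
  qed
  then have const: "?k i = ?k x" if "x \<in> pverts H" for x
    using harmonic_constant[of ?k, OF _ i that] by blast
  show ?thesis
    unfolding kemeny_def
  proof (rule the_equality)
    show "\<forall>x\<in>pverts H. ?k i = ?k x"
      using const by blast
    show "K = ?k i" if "\<forall>x\<in>pverts H. K = ?k x" for K
      using that i by blast
  qed
qed

lemma kemeny_eff_res:
  "kemeny H = (\<Sum>i\<in>pverts H. \<Sum>j\<in>pverts H. real (deg H i) * real (deg H j) * eff_res H i j)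
     / (4 * real (card (edges H)))"
proof -
  let ?m = "real (card (edges H))" and ?V = "pverts H"
  let ?D = "\<lambda>i j. real (deg H i) * real (deg H j)"
  have m: "?m > 0" using edges_pos by simp
  \<comment> \<open>The constant is averaged over all starting vertices with weights
    \<open>deg H i\<close>, which makes the double sum symmetric in its weights.\<close>
  have "4 * ?m\<^sup>2 * kemeny H = 2 * ?m * (\<Sum>i\<in>?V. real (deg H i)) * kemeny H"
    by (simp add: sum_deg_edges power2_eq_square)
  also have "\<dots> = (\<Sum>i\<in>?V. real (deg H i) * (2 * ?m * kemeny H))"
    by (simp add: sum_distrib_left sum_distrib_right mult_ac)
  also have "\<dots> = (\<Sum>i\<in>?V. \<Sum>j\<in>?V. ?D i j * hitting_time H i j)"
  proof (intro sum.cong refl)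
    fix i assume i: "i \<in> ?V"
    show "real (deg H i) * (2 * ?m * kemeny H) = (\<Sum>j\<in>?V. ?D i j * hitting_time H i j)"
      using m by (simp add: kemeny_start[OF i] stationary_def sum_distrib_left mult_ac)
  qed
  finally have k: "4 * ?m\<^sup>2 * kemeny H = (\<Sum>i\<in>?V. \<Sum>j\<in>?V. ?D i j * hitting_time H i j)" .
  also have "\<dots> = (\<Sum>i\<in>?V. \<Sum>j\<in>?V. ?D i j * hitting_time H j i)"
    by (subst sum.swap) (simp add: mult_ac)
  finally have k': "4 * ?m\<^sup>2 * kemeny H = (\<Sum>i\<in>?V. \<Sum>j\<in>?V. ?D i j * hitting_time H j i)" .
  \<comment> \<open>Adding both orders of each pair turns hitting times into commute times.\<close>
  have "8 * ?m\<^sup>2 * kemeny H = (\<Sum>i\<in>?V. \<Sum>j\<in>?V. ?D i j * (hitting_time H i j + hitting_time H j i))"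
    unfolding distrib_left sum.distrib using k k' by linarith
  also have "\<dots> = (\<Sum>i\<in>?V. \<Sum>j\<in>?V. 2 * ?m * (?D i j * eff_res H i j))"
    by (intro sum.cong refl) (simp add: eff_res_commute_time[symmetric] mult_ac)
  also have "\<dots> = 2 * ?m * (\<Sum>i\<in>?V. \<Sum>j\<in>?V. ?D i j * eff_res H i j)"
    by (simp add: sum_distrib_left)
  finally show ?thesis
    using m by (simp add: field_simps power2_eq_square)
qed

end

text \<open>Connectedness refers to the symmetric closure, which adds nothing when arcs are already
  symmetric.\<close>

lemma connected_graphI:
  assumes "pair_graph H" and conn: "Digraph_Component.connected (with_proj H)" and "edges H \<noteq> {}"
  shows "connected_graph H"
proof -
  interpret pair_graph H by fact
  have "(u, v) \<in> (parcs H)\<^sup>*" if "u \<in> pverts H" "v \<in> pverts H" for u v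
  proof -
    have "u \<rightarrow>\<^sup>*\<^bsub>mk_symmetric (with_proj H)\<^esub> v"
      using conn that by (auto simp: Digraph_Component.connected_def strongly_connected_def)
    then have "u \<rightarrow>\<^sup>*\<^bsub>with_proj H\<^esub> v"
      using reachable_mk_symmetric_eq[OF pair_sym_arcs] by simp
    then show ?thesis
      by (auto simp: reachable_def dest: rtrancl_on_rtranclI)
  qed
  then show ?thesis
    using assms(3) by unfold_locales (auto simp: edges_def)
qed

section \<open>Rearranging sums over pairs of distinct indices\<close>

lemma sum_offdiag_swap:
  fixes F :: "'i \<Rightarrow> 'i \<Rightarrow> real"
  assumes "finite A"
  shows "(\<Sum>i\<in>A. \<Sum>j\<in>A - {i}. F i j) = (\<Sum>i\<in>A. \<Sum>j\<in>A - {i}. F j i)"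
proof -
  have eq: "{j \<in> A. i \<noteq> j} = A - {i}" "{j \<in> A. j \<noteq> i} = A - {i}" for i by auto
  show ?thesis
    using sum.swap_restrict[OF assms assms, of F "(\<noteq>)"] by (simp add: eq)
qed

lemma sum_offdiag_symmetric:
  fixes F :: "nat \<Rightarrow> nat \<Rightarrow> real"
  assumes sym: "\<And>i j. F i j = F j i"
  shows "(\<Sum>i=1..n. \<Sum>j\<in>{1..n} - {i}. F i j) = 2 * (\<Sum>(i, j)\<in>{(i, j). 1 \<le> i \<and> i < j \<and> j \<le> n}. F i j)"
proof -
  let ?U = "{(i, j). 1 \<le> i \<and> i < j \<and> j \<le> n}" and ?D = "{(i, j). 1 \<le> j \<and> j < i \<and> i \<le> n}"
  have fin: "finite ?U" "finite ?D"
    by (auto intro: finite_subset[of _ "{1..n} \<times> {1..n}"])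
  have "(\<Sum>i=1..n. \<Sum>j\<in>{1..n} - {i}. F i j) = (\<Sum>(i, j)\<in>?U \<union> ?D. F i j)"
    by (subst sum.Sigma) (auto intro!: sum.cong)
  also have "\<dots> = (\<Sum>(i, j)\<in>?U. F i j) + (\<Sum>(i, j)\<in>?D. F i j)"
    using fin by (intro sum.union_disjoint) auto
  also have "(\<Sum>(i, j)\<in>?D. F i j) = (\<Sum>(i, j)\<in>?U. F i j)"
    by (rule sum.reindex_bij_witness[of _ prod.swap prod.swap]) (auto simp: sym)
  finally show ?thesis by simp
qed

section \<open>Chains of 1-sums\<close>

text \<open>Retraction of the disjoint union onto component \<open>i\<close>: everything to its left
  collapses to \<open>lv i\<close>, everything to its right to \<open>rv i\<close>. Composing with
  it extends functions on one component to the chain.\<close>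

definition component_proj :: "(nat \<Rightarrow> 'a) \<Rightarrow> (nat \<Rightarrow> 'a) \<Rightarrow> nat \<Rightarrow> nat \<times> 'a \<Rightarrow> 'a" where
  "component_proj lv rv i p = (if fst p = i then snd p else if fst p < i then lv i else rv i)"

text \<open>A gluing step into component \<open>i\<close> meets it at the very vertex to which that
  side collapses; every other step stays on one side of \<open>i\<close>.\<close>

lemma component_proj_glue:
  assumes "(p, q) \<in> glue n lv rv"
  shows "component_proj lv rv i p = component_proj lv rv i q"
proof -
  obtain k where "p = (k, rv k)" "q = (k + 1, lv (k + 1))"
    using assms by (auto simp: glue_def)
  then show ?thesis
    by (cases "k + 1 = i"; cases "k = i") (auto simp: component_proj_def)
qed

lemma component_proj_glue_equiv:
  assumes "(p, q) \<in> glue_equiv n lv rv"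
  shows "component_proj lv rv i p = component_proj lv rv i q"
  using assms unfolding glue_equiv_def
proof induction
  case (step q r)
  then show ?case using component_proj_glue by fastforce
qed simp

locale graph_chain =
  fixes n :: nat and G :: "nat \<Rightarrow> 'a pair_pre_digraph" and lv rv :: "nat \<Rightarrow> 'a"
  assumes n: "n \<ge> 1"
    and component: "i \<in> {1..n} \<Longrightarrow> connected_graph (G i)"
    and rv: "1 \<le> i \<Longrightarrow> i < n \<Longrightarrow> rv i \<in> pverts (G i)"
    and lv: "1 \<le> i \<Longrightarrow> i < n \<Longrightarrow> lv (i + 1) \<in> pverts (G (i + 1))"
begin

abbreviation C :: "(nat \<times> 'a) set pair_pre_digraph" where
  "C \<equiv> chain_sum n G lv rv"

abbreviation c :: "nat \<Rightarrow> 'a \<Rightarrow> (nat \<times> 'a) set" where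
  "c i x \<equiv> glue_class n lv rv i x"

text \<open>The choice of representative is harmless, because identified pairs have equal
  projections.\<close>

definition vertex_proj :: "nat \<Rightarrow> (nat \<times> 'a) set \<Rightarrow> 'a" where
  "vertex_proj i u = component_proj lv rv i (SOME p. p \<in> u)"

lemma vertex_proj: "vertex_proj i (c k z) = component_proj lv rv i (k, z)"
proof -
  have "(k, z) \<in> c k z"
    by (simp add: glue_class_def glue_equiv_def)
  then have "(SOME p. p \<in> c k z) \<in> c k z"
    by (rule someI)
  then show ?thesis
    unfolding vertex_proj_def
    by (auto simp: glue_class_def dest: component_proj_glue_equiv[where i = i])
qed

lemma vertex_proj_self [simp]: "vertex_proj i (c i z) = z"
  and vertex_proj_less: "k < i \<Longrightarrow> vertex_proj i (c k z) = lv i"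
  and vertex_proj_greater: "i < k \<Longrightarrow> vertex_proj i (c k z) = rv i"
  by (simp_all add: vertex_proj component_proj_def)

lemma class_inj: "c i x = c i y \<longleftrightarrow> x = y"
  by (metis vertex_proj_self)

lemma class_glue:
  assumes "1 \<le> i" "i < n"
  shows "c i (rv i) = c (i + 1) (lv (i + 1))"
proof -
  have equ: "equiv UNIV (glue_equiv n lv rv)"
    unfolding glue_equiv_def
    by (intro equivI refl_rtrancl sym_rtrancl trans_rtrancl sym_Un_converse) auto
  have "((i, rv i), (i + 1, lv (i + 1))) \<in> glue_equiv n lv rv"
    using assms by (auto simp: glue_equiv_def glue_def)
  then show ?thesis
    unfolding glue_class_def by (rule equiv_class_eq[OF equ])
qed

lemma class_in_verts: "i \<in> {1..n} \<Longrightarrow> x \<in> pverts (G i) \<Longrightarrow> c i x \<in> pverts C"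
  by (auto simp: chain_sum_def)

text \<open>If \<open>i\<close> and \<open>k\<close> differed, projecting to component
  \<open>k\<close> would collapse component \<open>i\<close> to one vertex and make the arc of
  \<open>G k\<close> a loop.\<close>

lemma arc_classes_inj:
  assumes "i \<in> {1..n}" "k \<in> {1..n}" "(x, y) \<in> parcs (G i)" "(x', y') \<in> parcs (G k)"
    and eq: "c i x = c k x'" "c i y = c k y'"
  shows "i = k \<and> x = x' \<and> y = y'"
proof -
  interpret K: connected_graph "G k" using assms by (simp add: component)
  have "i = k"
  proof (rule ccontr)
    assume ik: "i \<noteq> k"
    have "x' = vertex_proj k (c i x)" "y' = vertex_proj k (c i y)"
      using eq by simp_all
    then have "x' = y'"
      using ik by (simp add: vertex_proj component_proj_def)
    then show False using assms(4) by (auto dest: K.no_loops')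
  qed
  then show ?thesis using eq by (simp add: class_inj)
qed

text \<open>Components may share vertices but not arcs, so arc sums split with no correction at cut
  vertices.\<close>

lemma sum_chain_arcs:
  "(\<Sum>(u, v)\<in>parcs C. F u v) = (\<Sum>i=1..n. \<Sum>(x, y)\<in>parcs (G i). F (c i x) (c i y))"
proof -
  let ?S = "Sigma {1..n} (\<lambda>i. parcs (G i))"
  let ?\<phi> = "\<lambda>(i, x, y). (c i x, c i y)"
  have fin: "finite (parcs (G i))" if "i \<in> {1..n}" for i
  proof -
    interpret K: connected_graph "G i" using that by (rule component)
    show ?thesis by (rule K.pair_finite_arcs)
  qed
  have "inj_on ?\<phi> ?S"
    by (rule inj_onI) (auto simp del: atLeastAtMost_iff One_nat_def dest: arc_classes_inj)
  moreover have "parcs C = ?\<phi> ` ?S"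
    by (force simp: chain_sum_def)
  ultimately have "(\<Sum>(u, v)\<in>parcs C. F u v) = (\<Sum>p\<in>?S. case ?\<phi> p of (u, v) \<Rightarrow> F u v)"
    by (simp add: sum.reindex)
  also have "\<dots> = (\<Sum>(i, p)\<in>?S. case p of (x, y) \<Rightarrow> F (c i x) (c i y))"
    by (intro sum.cong) auto
  also have "\<dots> = (\<Sum>i=1..n. \<Sum>(x, y)\<in>parcs (G i). F (c i x) (c i y))"
    using fin by (subst sum.Sigma) auto
  finally show ?thesis .
qed

section \<open>Connectedness of the chain\<close>

lemma reach_component:
  assumes i: "i \<in> {1..n}" and xy: "x \<in> pverts (G i)" "y \<in> pverts (G i)"
  shows "(c i x, c i y) \<in> (parcs C)\<^sup>*"
proof -
  interpret connected_graph "G i" using i by (rule component)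
  from reach[OF xy] show ?thesis
  proof induction
    case (step y z)
    then have "(c i y, c i z) \<in> parcs C"
      using i by (auto simp: chain_sum_def)
    with step.IH show ?case by (rule rtrancl_into_rtrancl)
  qed simp
qed

lemma lv_in: "1 < i \<Longrightarrow> i \<le> n \<Longrightarrow> lv i \<in> pverts (G i)"
  using lv[of "i - 1"] by simp

text \<open>Inside component \<open>k + 1\<close> one reaches its left attaching vertex, which is
  also \<open>rv k\<close> in component \<open>k\<close>; induction leads back to component
  1.\<close>

lemma reach_first:
  assumes "i \<in> {1..n}" "x \<in> pverts (G i)" "y \<in> pverts (G 1)"
  shows "(c i x, c 1 y) \<in> (parcs C)\<^sup>*"
proof -
  have "1 \<le> i" "i \<le> n" using assms by auto
  then show ?thesis using assms(2)
  proof (induction i arbitrary: x rule: dec_induct)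
    case base
    then show ?case using assms n by (intro reach_component) auto
  next
    case (step k)
    have "(c (Suc k) x, c (Suc k) (lv (Suc k))) \<in> (parcs C)\<^sup>*"
      using step lv_in[of "Suc k"] by (intro reach_component) auto
    moreover have "c (Suc k) (lv (Suc k)) = c k (rv k)"
      using step class_glue[of k] by simp
    moreover have "(c k (rv k), c 1 y) \<in> (parcs C)\<^sup>*"
      using step rv by auto
    ultimately show ?case by simp
  qed
qed

lemma finite_chain_verts: "finite (pverts C)"
proof -
  have "pverts C = (\<Union>i\<in>{1..n}. c i ` pverts (G i))"
    by (auto simp: chain_sum_def, blast)
  moreover have "finite (pverts (G i))" if "i \<in> {1..n}" for i
  proof -
    interpret connected_graph "G i" using that by (rule component)
    show ?thesis by (rule finite_verts)
  qed
  ultimately show ?thesis by simp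
qed

lemma chain_arcE:
  assumes "(u, v) \<in> parcs C"
  obtains i x y where "i \<in> {1..n}" "(x, y) \<in> parcs (G i)" "u = c i x" "v = c i y"
  using assms by (auto simp: chain_sum_def)

lemma chain_arc_verts:
  assumes "(u, v) \<in> parcs C"
  shows "u \<in> pverts C \<and> v \<in> pverts C \<and> (v, u) \<in> parcs C \<and> u \<noteq> v"
  using assms
proof (rule chain_arcE)
  fix i x y assume i: "i \<in> {1..n}" and xy: "(x, y) \<in> parcs (G i)" "u = c i x" "v = c i y"
  interpret connected_graph "G i" using i by (rule component)
  have "x \<in> pverts (G i)" "y \<in> pverts (G i)" "x \<noteq> y" and yx: "(y, x) \<in> parcs (G i)"
    using xy by (auto dest: in_arcsD1 in_arcsD2 no_loops' arc_sym)
  moreover have "(v, u) \<in> parcs C"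
    using i yx xy by (auto simp: chain_sum_def)
  ultimately show ?thesis
    using xy i by (simp add: class_in_verts class_inj)
qed

lemma chain_connected_graph: "connected_graph C"
proof
  show "fst e \<in> pverts C" "snd e \<in> pverts C" "fst e \<noteq> snd e" if "e \<in> parcs C" for e
    using chain_arc_verts[of "fst e" "snd e"] that by simp_all
  show "finite (pverts C)" by (rule finite_chain_verts)
  show "finite (parcs C)"
    by (rule finite_subset[of _ "pverts C \<times> pverts C"])
       (auto simp: finite_chain_verts dest: chain_arc_verts)
  show "symmetric (with_proj C)"
    by (auto simp: symmetric_def intro!: symI dest: chain_arc_verts)
  interpret one: connected_graph "G 1" using n by (intro component) auto
  obtain x y where xy: "(x, y) \<in> parcs (G 1)" using one.arcs_nonempty by auto
  then have "(c 1 x, c 1 y) \<in> parcs C"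
    using n by (auto simp: chain_sum_def)
  then show "parcs C \<noteq> {}" by auto
  have x: "x \<in> pverts (G 1)" using xy by (rule one.in_arcsD1)
  have "sym ((parcs C)\<^sup>*)"
    by (intro sym_rtrancl symI) (auto dest: chain_arc_verts)
  moreover have "(u, c 1 x) \<in> (parcs C)\<^sup>*" if "u \<in> pverts C" for u
    using that reach_first x by (auto simp: chain_sum_def)
  ultimately show "(u, v) \<in> (parcs C)\<^sup>*" if "u \<in> pverts C" "v \<in> pverts C" for u v
    using that by (meson rtrancl_trans symD)
qed

sublocale chain: connected_graph C
  by (rule chain_connected_graph)

section \<open>Energy, degrees and resistances of the chain\<close>

lemma dirichlet_chain:
  "dirichlet C f g = (\<Sum>i=1..n. dirichlet (G i) (\<lambda>x. f (c i x)) (\<lambda>x. g (c i x)))"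
  by (simp add: dirichlet_def sum_chain_arcs)

text \<open>The degree of a glued vertex is the sum of its degrees in the components containing it;
  arc sums account for this automatically.\<close>

lemma sum_deg_chain:
  "(\<Sum>u\<in>pverts C. real (deg C u) * F u) =
     (\<Sum>i=1..n. \<Sum>x\<in>pverts (G i). real (deg (G i) x) * F (c i x))"
  unfolding chain.sum_deg sum_chain_arcs
proof (intro sum.cong refl)
  fix i assume i: "i \<in> {1..n}"
  interpret connected_graph "G i" using i by (rule component)
  show "(\<Sum>(x, y)\<in>parcs (G i). F (c i x)) = (\<Sum>x\<in>pverts (G i). real (deg (G i) x) * F (c i x))"
    by (rule sum_deg[symmetric])
qed

lemma card_edges_chain: "real (card (edges C)) = (\<Sum>i=1..n. real (card (edges (G i))))"
proof -
  have "2 * real (card (edges C)) = (\<Sum>i=1..n. \<Sum>x\<in>pverts (G i). real (deg (G i) x))"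
    using sum_deg_chain[of "\<lambda>_. 1"] by (simp add: chain.sum_deg_edges)
  also have "\<dots> = (\<Sum>i=1..n. 2 * real (card (edges (G i))))"
    by (intro sum.cong refl connected_graph.sum_deg_edges component)
  finally show ?thesis by (simp flip: sum_distrib_left)
qed

text \<open>A potential on one component extends to the chain by constants, since no current leaves it.\<close>

lemma unit_potential_lift:
  assumes i: "i \<in> {1..n}" and f: "unit_potential (G i) x y f"
  shows "unit_potential C (c i x) (c i y) (\<lambda>u. f (vertex_proj i u))"
proof -
  have "dirichlet C (\<lambda>u. f (vertex_proj i u)) g = 2 * (g (c i x) - g (c i y))" for g
  proof -
    have 0: "dirichlet (G k) (\<lambda>x. f (vertex_proj i (c k x))) (\<lambda>x. g (c k x)) = 0"
      if "k \<noteq> i" for k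
      using that by (simp add: dirichlet_def vertex_proj component_proj_def)
    have "dirichlet C (\<lambda>u. f (vertex_proj i u)) g =
        dirichlet (G i) (\<lambda>x. f (vertex_proj i (c i x))) (\<lambda>x. g (c i x))"
      unfolding dirichlet_chain using i by (subst sum.remove[of _ i]) (auto simp: 0)
    then show ?thesis using f by (simp add: unit_potential_def)
  qed
  then show ?thesis by (simp add: unit_potential_def)
qed

text \<open>The lifted potential keeps its values at both ends, and resistance is the potential
  difference in either graph.\<close>

lemma eff_res_same_component:
  assumes i: "i \<in> {1..n}" and x: "x \<in> pverts (G i)" and y: "y \<in> pverts (G i)"
  shows "eff_res C (c i x) (c i y) = eff_res (G i) x y"
proof -
  interpret connected_graph "G i" using i by (rule component)
  obtain f where f: "unit_potential (G i) x y f"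
    using unit_potential_hitting_time[OF x y] by blast
  show ?thesis
    using chain.eff_res_unit_potential[OF _ _ unit_potential_lift[OF i f]]
      eff_res_unit_potential[OF x y f] assms by (simp add: class_in_verts)
qed

lemma cut_vertex_pred: "1 < j \<Longrightarrow> j \<le> n \<Longrightarrow> cut_vertex n lv rv (j - 1) = c j (lv j)"
  using class_glue[of "j - 1"] by (simp add: cut_vertex_def)

text \<open>
  Superpose potentials for the three legs of the route. The outer two are constant beyond their own leg,
  and by reciprocity the middle one is therefore constant on the outer legs.
\<close>

lemma eff_res_different_components:
  assumes ij: "1 \<le> i" "i < j" "j \<le> n" and x: "x \<in> pverts (G i)" and y: "y \<in> pverts (G j)"
  shows "eff_res C (c i x) (c j y) = eff_res (G i) x (rv i)
    + eff_res C (cut_vertex n lv rv i) (cut_vertex n lv rv (j - 1)) + eff_res (G j) y (lv j)"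
proof -
  have i: "i \<in> {1..n}" and j: "j \<in> {1..n}" using ij by auto
  interpret I: connected_graph "G i" using i by (rule component)
  interpret J: connected_graph "G j" using j by (rule component)
  have r: "rv i \<in> pverts (G i)" and l: "lv j \<in> pverts (G j)"
    using ij by (auto intro: rv lv_in)
  let ?a = "c i (rv i)" and ?b = "c j (lv j)"
  have cut: "cut_vertex n lv rv i = ?a" "cut_vertex n lv rv (j - 1) = ?b"
    using ij cut_vertex_pred by (auto simp: cut_vertex_def)
  have V: "c i x \<in> pverts C" "c j y \<in> pverts C" "?a \<in> pverts C" "?b \<in> pverts C"
    using i j x y r l by (auto intro: class_in_verts)
  obtain f0 where f0: "unit_potential (G i) x (rv i) f0"
    using I.unit_potential_hitting_time[OF x r] by blast
  obtain h0 where h0: "unit_potential (G j) (lv j) y h0"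
    using J.unit_potential_hitting_time[OF l y] by blast
  obtain g where g: "unit_potential C ?a ?b g"
    using chain.unit_potential_hitting_time[OF V(3,4)] by blast
  define f where "f = (\<lambda>u. f0 (vertex_proj i u))"
  define h where "h = (\<lambda>u. h0 (vertex_proj j u))"
  have f: "unit_potential C (c i x) ?a f" and h: "unit_potential C ?b (c j y) h"
    unfolding f_def h_def by (rule unit_potential_lift[OF i f0], rule unit_potential_lift[OF j h0])
  have fc: "f ?a = f ?b" "f ?b = f (c j y)" and hc: "h ?a = h ?b" "h (c i x) = h ?a"
    using ij by (simp_all add: f_def h_def vertex_proj_less vertex_proj_greater)
  have "eff_res C (c i x) (c j y) = (f (c i x) + g (c i x) + h (c i x)) - (f (c j y) + g (c j y) + h (c j y))"
    by (rule chain.eff_res_unit_potential[OF V(1,2) unit_potential_add[OF unit_potential_add[OF f g] h]])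
  moreover have "g (c i x) = g ?a" "g ?b = g (c j y)"
    using unit_potential_reciprocity[OF f g] unit_potential_reciprocity[OF g h] fc hc by simp_all
  moreover have "eff_res C ?a ?b = g ?a - g ?b"
    by (rule chain.eff_res_unit_potential[OF V(3,4) g])
  moreover have "eff_res (G i) x (rv i) = f (c i x) - f ?a"
    using I.eff_res_unit_potential[OF x r f0] by (simp add: f_def)
  moreover have "eff_res (G j) y (lv j) = h ?b - h (c j y)"
    using J.eff_res_unit_potential[OF l y h0] J.eff_res_commute[of y "lv j"] by (simp add: h_def)
  ultimately show ?thesis
    unfolding cut using fc hc by simp
qed

section \<open>Degree-weighted resistance sums between components\<close>

definition cross :: "nat \<Rightarrow> nat \<Rightarrow> real" where
  "cross i j = (\<Sum>x\<in>pverts (G i). \<Sum>y\<in>pverts (G j).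
     real (deg (G i) x) * real (deg (G j) y) * eff_res C (c i x) (c j y))"

lemma kemeny_chain:
  "kemeny C = (\<Sum>i=1..n. \<Sum>j=1..n. cross i j) / (4 * (\<Sum>i=1..n. real (card (edges (G i)))))"
proof -
  \<comment> \<open>Pulling out the outer degree brings both sums into the form that
    \<open>sum_deg_chain\<close> splits.\<close>
  have "(\<Sum>u\<in>pverts C. \<Sum>v\<in>pverts C. real (deg C u) * real (deg C v) * eff_res C u v) =
      (\<Sum>u\<in>pverts C. real (deg C u) * (\<Sum>v\<in>pverts C. real (deg C v) * eff_res C u v))"
    by (simp add: sum_distrib_left mult.assoc)
  also have "\<dots> = (\<Sum>i=1..n. \<Sum>x\<in>pverts (G i). \<Sum>j=1..n. \<Sum>y\<in>pverts (G j).
      real (deg (G i) x) * real (deg (G j) y) * eff_res C (c i x) (c j y))"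
    unfolding sum_deg_chain by (simp add: sum_distrib_left mult.assoc)
  also have "\<dots> = (\<Sum>i=1..n. \<Sum>j=1..n. cross i j)"
    unfolding cross_def by (intro sum.cong refl sum.swap)
  finally show ?thesis
    by (simp add: chain.kemeny_eff_res card_edges_chain)
qed

text \<open>Resistances within a component are those of \<open>G i\<close>, so this is
  \<open>kemeny_eff_res\<close> read backwards.\<close>

lemma cross_self:
  assumes i: "i \<in> {1..n}"
  shows "cross i i = 4 * real (card (edges (G i))) * kemeny (G i)"
proof -
  interpret connected_graph "G i" using i by (rule component)
  have "cross i i = (\<Sum>x\<in>pverts (G i). \<Sum>y\<in>pverts (G i).
      real (deg (G i) x) * real (deg (G i) y) * eff_res (G i) x y)"
    unfolding cross_def using i by (intro sum.cong refl) (simp add: eff_res_same_component)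
  then show ?thesis using edges_pos by (simp add: kemeny_eff_res)
qed

lemma cross_commute: "cross i j = cross j i"
  unfolding cross_def
  by (subst sum.swap) (simp add: chain.eff_res_commute[of "c j _"] mult.commute)

text \<open>Resistance adds along the route, so the sum multiplies out: the outer legs give moments,
  and each free degree sum gives \<open>2m\<close>.\<close>

lemma cross_less:
  assumes ij: "1 \<le> i" "i < j" "j \<le> n"
  shows "cross i j = 2 * real (card (edges (G j))) * moment (G i) (rv i)
    + 2 * real (card (edges (G i))) * moment (G j) (lv j)
    + 4 * real (card (edges (G i))) * real (card (edges (G j)))
        * eff_res C (cut_vertex n lv rv i) (cut_vertex n lv rv (j - 1))"
proof -
  have i: "i \<in> {1..n}" and j: "j \<in> {1..n}" using ij by auto
  interpret I: connected_graph "G i" using i by (rule component)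
  interpret J: connected_graph "G j" using j by (rule component)
  let ?R = "eff_res C (cut_vertex n lv rv i) (cut_vertex n lv rv (j - 1))"
  let ?d = "\<lambda>x. real (deg (G i) x)" and ?e = "\<lambda>y. real (deg (G j) y)"
  have "cross i j = (\<Sum>x\<in>pverts (G i). \<Sum>y\<in>pverts (G j).
      ?d x * eff_res (G i) x (rv i) * ?e y + ?d x * (?e y * eff_res (G j) y (lv j)) + ?d x * ?e y * ?R)"
    unfolding cross_def
    by (intro sum.cong refl) (simp add: eff_res_different_components[OF ij] algebra_simps)
  also have "\<dots> = (\<Sum>x\<in>pverts (G i). ?d x * eff_res (G i) x (rv i)) * (\<Sum>y\<in>pverts (G j). ?e y)
      + (\<Sum>x\<in>pverts (G i). ?d x) * (\<Sum>y\<in>pverts (G j). ?e y * eff_res (G j) y (lv j))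
      + (\<Sum>x\<in>pverts (G i). ?d x) * (\<Sum>y\<in>pverts (G j). ?e y) * ?R"
    unfolding sum.distrib sum_product by (simp only: sum_distrib_right)
  finally show ?thesis
    unfolding I.sum_deg_edges J.sum_deg_edges by (simp add: moment_def algebra_simps)
qed

text \<open>\<open>min\<close> and \<open>max\<close> make this symmetric, so that a sum over
  ordered pairs folds onto \<open>i < j\<close>.\<close>

definition cut_res :: "nat \<Rightarrow> nat \<Rightarrow> real" where
  "cut_res i j = eff_res C (cut_vertex n lv rv (min i j)) (cut_vertex n lv rv (max i j - 1))"

lemma cross_distinct:
  assumes "i \<in> {1..n}" "j \<in> {1..n}" "i \<noteq> j"
  shows "cross i j = 2 * (real (card (edges (G j))) * moment (G i) (facing_vertex lv rv j i))
    + 2 * (real (card (edges (G i))) * moment (G j) (facing_vertex lv rv i j))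
    + 4 * (real (card (edges (G i))) * real (card (edges (G j))) * cut_res i j)"
proof (cases "i < j")
  case True
  then show ?thesis
    using assms cross_less[of i j] by (simp add: facing_vertex_def cut_res_def)
next
  case False
  then show ?thesis
    using assms cross_less[of j i] cross_commute[of i j] by (simp add: facing_vertex_def cut_res_def)
qed

text \<open>Both ends of the middle leg are the same cut vertex; hence only pairs with
  \<open>j - i \<ge> 2\<close> appear in the formula.\<close>

lemma cut_res_adjacent:
  "cut_res i (Suc i) = 0"
  by (simp add: cut_res_def chain.eff_res_self)

end

theorem theorem2p3:
  fixes n :: nat
    and G :: "nat \<Rightarrow> 'a pair_pre_digraph"
    and lv rv :: "nat \<Rightarrow> 'a"
    and m :: "nat \<Rightarrow> real"
  assumes n: "n \<ge> 1"
    and graph: "\<And>i. i \<in> {1..n} \<Longrightarrow> pair_graph (G i)"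
    and connected: "\<And>i. i \<in> {1..n} \<Longrightarrow> Digraph_Component.connected (with_proj (G i))"
    and nonempty: "\<And>i. i \<in> {1..n} \<Longrightarrow> edges (G i) \<noteq> {}"
    and rv: "\<And>i. 1 \<le> i \<Longrightarrow> i < n \<Longrightarrow> rv i \<in> pverts (G i)"
    and lv: "\<And>i. 1 \<le> i \<Longrightarrow> i < n \<Longrightarrow> lv (i + 1) \<in> pverts (G (i + 1))"
    and m: "\<And>i. i \<in> {1..n} \<Longrightarrow> m i = real (card (edges (G i)))"
  shows "kemeny (chain_sum n G lv rv) =
    ((\<Sum>i=1..n. m i * (kemeny (G i) + (\<Sum>j\<in>{1..n} - {i}. moment (G j) (facing_vertex lv rv i j))))
     + 2 * (\<Sum>(i, j)\<in>{(i, j). 1 \<le> i \<and> i < j \<and> j \<le> n \<and> j - i \<ge> 2}.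
          m i * m j * eff_res (chain_sum n G lv rv) (cut_vertex n lv rv i) (cut_vertex n lv rv (j - 1))))
    / (\<Sum>i=1..n. m i)"
proof -
  interpret graph_chain n G lv rv
    by (intro graph_chain.intro connected_graphI n graph connected nonempty rv lv)
  let ?A = "{1..n}"
  let ?\<mu> = "\<lambda>i j. moment (G j) (facing_vertex lv rv i j)"
  let ?U = "{(i, j). 1 \<le> i \<and> i < j \<and> j \<le> n}"
  let ?U2 = "{(i, j). 1 \<le> i \<and> i < j \<and> j \<le> n \<and> j - i \<ge> 2}"
  \<comment> \<open>The numerator splits into the contribution within components, the moments, and
    the resistances between cut vertices.\<close>
  define K where "K = (\<Sum>i\<in>?A. m i * kemeny (G i))"
  define M where "M = (\<Sum>i\<in>?A. \<Sum>j\<in>?A - {i}. m i * ?\<mu> i j)"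
  define R where "R = (\<Sum>(i, j)\<in>?U2. m i * m j *
    eff_res C (cut_vertex n lv rv i) (cut_vertex n lv rv (j - 1)))"
  have R: "R = (\<Sum>(i, j)\<in>?U. m i * m j * cut_res i j)"
    unfolding R_def
  proof (rule sum.mono_neutral_cong_left)
    show "finite ?U"
      by (auto intro: finite_subset[of _ "?A \<times> ?A"])
    show "\<forall>p\<in>?U - ?U2. (case p of (i, j) \<Rightarrow> m i * m j * cut_res i j) = 0"
    proof
      fix p assume "p \<in> ?U - ?U2"
      then obtain i where "p = (i, Suc i)" "1 \<le> i" "i < n"
        by (cases p) (auto simp: not_le less_Suc_eq_le numeral_2_eq_2)
      then show "(case p of (i, j) \<Rightarrow> m i * m j * cut_res i j) = 0"
        by (simp add: cut_res_adjacent)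
    qed
  qed (auto simp: cut_res_def)
  have "(\<Sum>i\<in>?A. \<Sum>j\<in>?A. cross i j) = (\<Sum>i\<in>?A. cross i i) + (\<Sum>i\<in>?A. \<Sum>j\<in>?A - {i}. cross i j)"
    by (simp add: sum.remove flip: sum.distrib)
  also have "(\<Sum>i\<in>?A. cross i i) = 4 * K"
    unfolding K_def sum_distrib_left by (intro sum.cong refl) (simp add: cross_self m)
  also have "(\<Sum>i\<in>?A. \<Sum>j\<in>?A - {i}. cross i j) =
      (\<Sum>i\<in>?A. \<Sum>j\<in>?A - {i}. 2 * (m j * ?\<mu> j i) + 2 * (m i * ?\<mu> i j) + 4 * (m i * m j * cut_res i j))"
    by (intro sum.cong refl) (simp add: cross_distinct m)
  also have "\<dots> = 2 * (\<Sum>i\<in>?A. \<Sum>j\<in>?A - {i}. m j * ?\<mu> j i) + 2 * M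
      + 4 * (\<Sum>i\<in>?A. \<Sum>j\<in>?A - {i}. m i * m j * cut_res i j)"
    unfolding M_def by (simp only: sum.distrib sum_distrib_left)
  \<comment> \<open>Exchanging the names of \<open>i\<close> and \<open>j\<close> identifies the two
    families of moment terms.\<close>
  also have "(\<Sum>i\<in>?A. \<Sum>j\<in>?A - {i}. m j * ?\<mu> j i) = M"
    unfolding M_def by (rule sum_offdiag_swap) simp
  \<comment> \<open>Each pair \<open>i < j\<close> is counted in both orders, the source of the
    factor 2 before the resistance sum.\<close>
  also have "(\<Sum>i\<in>?A. \<Sum>j\<in>?A - {i}. m i * m j * cut_res i j) = 2 * R"
    unfolding R by (rule sum_offdiag_symmetric) (simp add: cut_res_def min.commute max.commute)
  finally have "(\<Sum>i\<in>?A. \<Sum>j\<in>?A. cross i j) = 4 * (K + M + 2 * R)"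
    by simp
  moreover have "(\<Sum>i\<in>?A. real (card (edges (G i)))) = (\<Sum>i\<in>?A. m i)"
    by (intro sum.cong) (auto simp: m)
  ultimately have "kemeny C = (K + M + 2 * R) / (\<Sum>i\<in>?A. m i)"
    unfolding kemeny_chain by (simp only: mult_divide_mult_cancel_left_if) simp
  moreover have "K + M = (\<Sum>i\<in>?A. m i * (kemeny (G i) + (\<Sum>j\<in>?A - {i}. ?\<mu> i j)))"
    by (simp add: K_def M_def distrib_left sum.distrib sum_distrib_left)
  ultimately show ?thesis
    unfolding R_def by simp
qed

end
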